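(* Let $\{X_k, k\in\mathbb{N}\}$ be a standardized Gaussian process. Assume that for some $\delta>0$ its dependence measure satisfies $$\Delta(n)=O\left(n^2(\ln n)^{-3-\delta}\right)\quad\text{as } n\to\infty.$$ Then $$\sup_{t\in\mathbb{R}}\left|\widehat{F}_n(t)-\mathbf{E}\widehat{F}_n(t)\right|\xrightarrow{a.s.}0\quad\text{as } n\to\infty,$$ where $\xrightarrow{a.s.}$ denotes almost sure convergence.
   Context: Here $\mathbb{N}=\{1,2,3,\dots\}$. A stochastic process $\{X_k,k\in\mathbb{N}\}$ of real random variables on a common probability space is a Gaussian process if for every finite set of indices $\{k_1,\dots,k_m\}$, $m\ge 1$, the joint distribution of $(X_{k_1},\dots,X_{k_m})$ is multivariate Gaussian (possibly degenerate). It is a standardized Gaussian process if in addition $X_k\sim\mathcal{N}(0,1)$ for every $k\in\mathbb{N}$. Let $\Phi$ be the cumulative distribution function of the standard Gaussian $\mathcal{N}(0,1)$. The empirical distribution is $$\widehat{F}_n(t)=\frac1n\sum_{i=1}^n\mathbf{1}(\Phi(X_i)\le t),\qquad t\in\mathbb{R},$$ where $\mathbf{1}(A)$ is the indicator of the event $A$. The dependence measure is $$\Delta(n)=2\sum_{1\le i<j\le n}|\mathrm{Cov}(X_i,X_j)|.$$ *)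

theory Defs
  imports "HOL-Probability.Probability" "HOL-Library.Landau_Symbols"
begin

text \<open>A Gaussian law on the real line; the point masses are the degenerate case of zero variance.\<close>

definition gaussian_law :: "real measure \<Rightarrow> bool" where
  "gaussian_law \<nu> \<longleftrightarrow>
     (\<exists>\<mu> \<sigma>. 0 < \<sigma> \<and> \<nu> = density lborel (normal_density \<mu> \<sigma>)) \<or> (\<exists>\<mu>. \<nu> = return borel \<mu>)"

text \<open>A law on the finite-dimensional space of real vectors indexed by \<open>J\<close> is multivariate
  Gaussian (possibly degenerate) iff its image under every linear functional is Gaussian.\<close>

definition multivariate_gaussian_law :: "'i set \<Rightarrow> ('i \<Rightarrow> real) measure \<Rightarrow> bool" where
  "multivariate_gaussian_law J \<nu> \<longleftrightarrow>
     sets \<nu> = sets (\<Pi>\<^sub>M k\<in>J. (borel :: real measure)) \<and>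
     (\<forall>c :: 'i \<Rightarrow> real. gaussian_law (distr \<nu> borel (\<lambda>x. \<Sum>k\<in>J. c k * x k)))"

text \<open>Processes are indexed by the positive integers, so \<open>X 0\<close> is unconstrained and never used.\<close>

definition gaussian_process :: "'a measure \<Rightarrow> (nat \<Rightarrow> 'a \<Rightarrow> real) \<Rightarrow> bool" where
  "gaussian_process M X \<longleftrightarrow>
     (\<forall>k\<ge>1. X k \<in> borel_measurable M) \<and>
     (\<forall>J. finite J \<and> J \<noteq> {} \<and> J \<subseteq> {1..} \<longrightarrow>
        multivariate_gaussian_law J
          (distr M (\<Pi>\<^sub>M k\<in>J. (borel :: real measure)) (\<lambda>\<omega>. \<lambda>k\<in>J. X k \<omega>)))"

definition standardized_gaussian_process :: "'a measure \<Rightarrow> (nat \<Rightarrow> 'a \<Rightarrow> real) \<Rightarrow> bool" where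
  "standardized_gaussian_process M X \<longleftrightarrow>
     gaussian_process M X \<and> (\<forall>k\<ge>1. distr M borel (X k) = std_normal_distribution)"

definition covariance :: "'a measure \<Rightarrow> ('a \<Rightarrow> real) \<Rightarrow> ('a \<Rightarrow> real) \<Rightarrow> real" where
  "covariance M Y Z =
     (\<integral>\<omega>. (Y \<omega> - integral\<^sup>L M Y) * (Z \<omega> - integral\<^sup>L M Z) \<partial>M)"

definition dependence_measure :: "'a measure \<Rightarrow> (nat \<Rightarrow> 'a \<Rightarrow> real) \<Rightarrow> nat \<Rightarrow> real" where
  "dependence_measure M X n =
     2 * (\<Sum>j\<in>{1..n}. \<Sum>i\<in>{1..<j}. \<bar>covariance M (X i) (X j)\<bar>)"

definition std_normal_cdf :: "real \<Rightarrow> real" where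
  "std_normal_cdf = cdf std_normal_distribution"

definition empirical_cdf :: "(nat \<Rightarrow> 'a \<Rightarrow> real) \<Rightarrow> nat \<Rightarrow> real \<Rightarrow> 'a \<Rightarrow> real" where
  "empirical_cdf X n t \<omega> =
     1 / real n * (\<Sum>i\<in>{1..n}. indicator {..t} (std_normal_cdf (X i \<omega>)))"

end

theory Submission
  imports Defs "HOL-Real_Asymp.Real_Asymp"
begin

text \<open>
  Characteristic functions reduce the theorem to a second-moment bound that follows from
  the one-dimensional Gaussian laws of the \<open>X\<^sub>k\<close> and of the differences \<open>X\<^sub>j - X\<^sub>k\<close>.
  Let \<open>\<phi>\<^sub>n s\<close> be the average of \<open>exp (\<i> s X\<^sub>k)\<close> over \<open>k \<le> n\<close>, that is, the characteristic function of the
  random measure that puts mass \<open>1 / n\<close> on each of \<open>X\<^sub>1, \<dots>, X\<^sub>n\<close>. For \<open>j \<noteq> k\<close> the difference \<open>X\<^sub>j - X\<^sub>k\<close> is a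
  centered Gaussian of variance \<open>2 (1 - \<rho>)\<close> with \<open>\<rho> = Cov(X\<^sub>j, X\<^sub>k)\<close>, so the real part of the covariance of
  \<open>exp (\<i> s X\<^sub>j)\<close> and \<open>exp (\<i> s X\<^sub>k)\<close> equals \<open>exp (- s\<^sup>2 (1 - \<rho>)) - exp (- s\<^sup>2) \<le> s\<^sup>2 \<bar>\<rho>\<bar>\<close>. Summation gives
  \<open>E \<bar>\<phi>\<^sub>n s - exp (- s\<^sup>2 / 2)\<bar>\<^sup>2 \<le> 1 / n + s\<^sup>2 \<Delta>(n) / n\<^sup>2\<close> (lemma \<open>expectation_norm_sum_iexp_le\<close>), and the
  hypothesis on \<open>\<Delta>\<close> makes this \<open>O((ln n) powr (- 3 - \<delta>))\<close>. Along indices close to \<open>exp (sqrt k)\<close> these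
  bounds are summable; consecutive such indices have ratio tending to 1, so boundedness of the
  terms fills the gaps, and for each \<open>s\<close> almost surely \<open>\<phi>\<^sub>n s \<rightarrow> exp (- s\<^sup>2 / 2)\<close>
  (lemma \<open>AE_average_tendsto_0\<close>).

  By Fubini, almost surely the convergence holds for almost every \<open>s\<close>. This is as good as every
  \<open>s\<close>: the bound \<open>\<bar>\<phi> s - \<phi> t\<bar>\<^sup>2 \<le> 2 (1 - Re (\<phi> (s - t)))\<close> controls \<open>\<phi>\<^sub>n\<close> at any point by its values at two
  good points (theorem \<open>levy_continuity_AE\<close>). Hence almost surely the empirical measures of the
  \<open>X\<^sub>k\<close> converge weakly to the standard normal law. As \<open>\<Phi>\<close> is continuous, the distribution functions
  converge uniformly (lemma \<open>polya_uniform_cdf\<close>). Finally every set \<open>{x. \<Phi> x \<le> t}\<close> is empty, the whole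
  line or a half-line \<open>{..a}\<close>, so the supremum over \<open>t\<close> is at most the supremum over \<open>a\<close>.
\<close>

section \<open>Almost everywhere convergence of characteristic functions\<close>

text \<open>By Jensen, the square of the mean of \<open>exp (\<i> s x) - exp (\<i> t x)\<close> is at most the mean of the squared
  modulus, which depends on \<open>s - t\<close> only.\<close>

lemma norm_char_diff_sq_le:
  assumes "real_distribution N"
  shows "(norm (char N s - char N t))\<^sup>2 \<le> 2 * (1 - Re (char N (s - t)))"
proof -
  interpret N: real_distribution N by fact
  have int: "integrable N (\<lambda>x. iexp (u * x))" for u
    using N.integrable_iexp[of "\<lambda>x. complex_of_real (u*x)"] by simp
  have sq: "(norm (iexp (s * x) - iexp (t * x)))\<^sup>2 = 2 - 2 * Re (iexp ((s - t) * x))" for x :: real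
  proof -
    have "Re (iexp ((s - t) * x)) = cos (s * x) * cos (t * x) + sin (s * x) * sin (t * x)"
      by (simp add: Re_exp left_diff_distrib cos_diff)
    moreover have "(norm (iexp (s * x) - iexp (t * x)))\<^sup>2
        = (cos (s * x) - cos (t * x))\<^sup>2 + (sin (s * x) - sin (t * x))\<^sup>2"
      by (simp add: cmod_power2 Re_exp Im_exp)
    moreover have "(sin (s * x))\<^sup>2 + (cos (s * x))\<^sup>2 = 1" "(sin (t * x))\<^sup>2 + (cos (t * x))\<^sup>2 = 1"
      by simp_all
    ultimately show ?thesis by (simp add: power2_eq_square algebra_simps)
  qed
  define g where "g x = norm (iexp (s * x) - iexp (t * x))" for x :: real
  have g_le: "\<bar>g x\<bar> \<le> 2" for x
    unfolding g_def using norm_triangle_ineq4[of "iexp (s * x)" "iexp (t * x)"] by simp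
  have [measurable]: "g \<in> borel_measurable N"
    unfolding g_def by measurable
  have ig: "integrable N g"
    by (rule N.integrable_const_bound[of _ 2]) (use g_le in auto)
  have ig2: "integrable N (\<lambda>x. (g x)\<^sup>2)"
    unfolding g_def sq
    by (intro Bochner_Integration.integrable_diff integrable_mult_right integrable_Re int) simp_all
  have "norm (char N s - char N t) \<le> N.expectation g"
    unfolding char_def g_def Bochner_Integration.integral_diff[OF int int, symmetric]
    by (rule integral_norm_bound)
  then have "(norm (char N s - char N t))\<^sup>2 \<le> (N.expectation g)\<^sup>2"
    by (intro power_mono) auto
  also have "\<dots> \<le> N.expectation (\<lambda>x. (g x)\<^sup>2)"
    using N.variance_positive[of g] N.variance_eq[OF ig ig2] by simp
  also have "\<dots> = 2 - 2 * Re (char N (s - t))"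
  proof -
    define h where "h x = Re (iexp ((s - t) * x))" for x :: real
    have "integrable N h" "N.expectation h = Re (char N (s - t))"
      unfolding h_def char_def using int[of "s - t"] by (rule integrable_Re, rule integral_Re)
    moreover from this(1) have "N.expectation (\<lambda>x. 2 - 2 * h x) = 2 - 2 * N.expectation h"
      using N.prob_space by simp
    ultimately show ?thesis unfolding g_def sq h_def by simp
  qed
  finally show ?thesis by simp
qed

text \<open>Convergence of countably many measurable functions involves only countable quantifiers; this
  makes Fubini applicable to exceptional sets of convergence.\<close>

lemma pred_tendsto_0:
  fixes f :: "nat \<Rightarrow> 'a \<Rightarrow> real"
  assumes [measurable]: "\<And>n. f n \<in> borel_measurable M"
  shows "Measurable.pred M (\<lambda>x. (\<lambda>n. f n x) \<longlonglongrightarrow> 0)"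
proof -
  have "(g \<longlonglongrightarrow> 0) \<longleftrightarrow> (\<forall>i. \<exists>m. \<forall>n\<ge>m. \<bar>g n\<bar> < inverse (real (Suc i)))" for g :: "nat \<Rightarrow> real"
  proof (intro iffI allI LIMSEQ_I)
    fix i assume "g \<longlonglongrightarrow> 0"
    from LIMSEQ_D[OF this, of "inverse (real (Suc i))"]
    show "\<exists>m. \<forall>n\<ge>m. \<bar>g n\<bar> < inverse (real (Suc i))" by simp
  next
    fix e :: real assume *: "\<forall>i. \<exists>m. \<forall>n\<ge>m. \<bar>g n\<bar> < inverse (real (Suc i))" and "e > 0"
    then obtain i where "inverse (real (Suc i)) < e" using reals_Archimedean by blast
    with * show "\<exists>m. \<forall>n\<ge>m. norm (g n - 0) < e" by (metis diff_zero order_less_trans real_norm_def)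
  qed
  then show ?thesis by simp
qed

text \<open>Fix any \<open>t\<close>. For almost every \<open>u\<close> both \<open>u\<close> and \<open>t - u\<close> are points of convergence, so such a \<open>u\<close> exists
  arbitrarily close to \<open>t\<close>. There \<open>char (N n) u\<close> converges, and \<open>char (N n) t\<close> differs from it by at most
  \<open>sqrt (2 * (1 - Re (char (N n) (t - u))))\<close>, whose limit is small because \<open>char N'\<close> is continuous at
  0. So convergence at almost every point forces convergence everywhere.\<close>

theorem levy_continuity_AE:
  fixes N :: "nat \<Rightarrow> real measure" and N' :: "real measure"
  assumes N: "\<And>n. real_distribution (N n)" and N': "real_distribution N'"
    and conv: "AE t in lborel. (\<lambda>n. char (N n) t) \<longlonglongrightarrow> char N' t"
  shows "weak_conv_m N N'"
proof (rule levy_continuity[OF N N'])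
  interpret N': real_distribution N' by fact
  fix t :: real
  show "(\<lambda>n. char (N n) t) \<longlonglongrightarrow> char N' t"
  proof (rule LIMSEQ_I)
    fix e :: real assume e: "e > 0"
    have cont: "isCont (char N') u" for u by (rule N'.isCont_char)
    have "((\<lambda>u. norm (char N' u - char N' t)) \<longlongrightarrow> 0) (at t)"
      using cont[of t] by (intro tendsto_eq_intros) (auto simp: isCont_def)
    moreover have "((\<lambda>u. sqrt (2 * (1 - Re (char N' (t - u))))) \<longlongrightarrow> 0) (at t)"
    proof -
      have "isCont (\<lambda>u. char N' (t - u)) t"
        by (rule isCont_o2[where f="\<lambda>u. t - u"]) (auto intro: cont)
      then have "isCont (\<lambda>u. sqrt (2 * (1 - Re (char N' (t - u))))) t"
        by (intro continuous_intros isCont_Re)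
      then show ?thesis by (simp add: isCont_def N'.char_zero)
    qed
    ultimately have "eventually (\<lambda>u. norm (char N' u - char N' t) < e / 4 \<and>
        sqrt (2 * (1 - Re (char N' (t - u)))) < e / 4) (at t)"
      using e by (intro eventually_conj order_tendstoD) auto
    then obtain d where d: "d > 0" and du: "\<And>u. u \<noteq> t \<Longrightarrow> dist u t < d \<Longrightarrow>
        norm (char N' u - char N' t) < e / 4 \<and> sqrt (2 * (1 - Re (char N' (t - u)))) < e / 4"
      by (auto simp: eventually_at)
    have char_meas [measurable]: "char L \<in> borel_measurable borel" if "real_distribution L" for L
      using real_distribution.isCont_char[OF that]
      by (intro borel_measurable_continuous_onI continuous_at_imp_continuous_on) auto
    have pred: "Measurable.pred borel (\<lambda>u. (\<lambda>n. char (N n) u) \<longlonglongrightarrow> char N' u)"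
    proof -
      have "Measurable.pred borel (\<lambda>u. (\<lambda>n. norm (char (N n) u - char N' u)) \<longlonglongrightarrow> 0)"
        by (intro pred_tendsto_0 measurable_compose[OF _ borel_measurable_norm]
            borel_measurable_diff char_meas N N')
      then show ?thesis by (simp only: tendsto_norm_zero_iff LIM_zero_iff)
    qed
    have conv': "AE u in lborel. (\<lambda>n. char (N n) (t - u)) \<longlonglongrightarrow> char N' (t - u)"
      using AE_borel_affine[of "-1" "\<lambda>u. (\<lambda>n. char (N n) u) \<longlonglongrightarrow> char N' u" t, OF _ pred conv] by simp
    have non_null: "\<not> (AE u in lborel. u \<notin> {t<..<t+d})"
    proof
      assume "AE u in lborel. u \<notin> {t<..<t+d}"
      then have "emeasure lborel {t<..<t+d} = 0"
        by (subst (asm) AE_iff_measurable[of "{t<..<t+d}"]) auto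
      then show False using d by simp
    qed
    obtain u where u: "t < u" "u < t + d"
      and c1: "(\<lambda>n. char (N n) u) \<longlonglongrightarrow> char N' u"
      and c2: "(\<lambda>n. char (N n) (t - u)) \<longlonglongrightarrow> char N' (t - u)"
    proof (atomize_elim, rule ccontr)
      assume that: "\<not> (\<exists>u. t < u \<and> u < t + d \<and>
          (\<lambda>n. char (N n) u) \<longlonglongrightarrow> char N' u \<and> (\<lambda>n. char (N n) (t - u)) \<longlonglongrightarrow> char N' (t - u))"
      have "AE u in lborel. u \<notin> {t<..<t+d}"
        using conv conv' by eventually_elim (use that in auto)
      then show False using non_null by simp
    qed
    have du: "norm (char N' u - char N' t) < e / 4" "sqrt (2 * (1 - Re (char N' (t - u)))) < e / 4"
      using du[of u] u by (auto simp: dist_real_def)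
    have "(\<lambda>n. sqrt (2 * (1 - Re (char (N n) (t - u))))) \<longlonglongrightarrow> sqrt (2 * (1 - Re (char N' (t - u))))"
      by (intro tendsto_intros c2)
    from order_tendstoD(2)[OF this du(2)] obtain n1 where
      n1: "\<And>n. n \<ge> n1 \<Longrightarrow> sqrt (2 * (1 - Re (char (N n) (t - u)))) < e / 4"
      by (auto simp: eventually_sequentially)
    from LIMSEQ_D[OF c1, of "e/4"] e obtain n2 where
      n2: "\<And>n. n \<ge> n2 \<Longrightarrow> norm (char (N n) u - char N' u) < e / 4" by auto
    have "norm (char (N n) t - char N' t) < e" if n: "n \<ge> max n1 n2" for n
    proof -
      have "norm (char (N n) t - char (N n) u) \<le> sqrt (2 * (1 - Re (char (N n) (t - u))))"
        using norm_char_diff_sq_le[OF N] by (intro real_le_rsqrt) auto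
      moreover have "norm (char (N n) t - char N' t) \<le> norm (char (N n) t - char (N n) u)
          + norm (char (N n) u - char N' u) + norm (char N' u - char N' t)"
        by (rule order_trans[OF _ add_mono[OF norm_triangle_ineq order_refl]], rule order_trans[OF _ norm_triangle_ineq]) simp
      ultimately show ?thesis using n1[of n] n2[of n] n du e by auto
    qed
    then show "\<exists>no. \<forall>n\<ge>no. norm (char (N n) t - char N' t) < e" by blast
  qed
qed

section \<open>Uniform convergence of distribution functions\<close>

text \<open>Polya's theorem: by monotonicity, closeness on the finite grid of the \<open>j / m\<close>-quantiles of \<open>F\<close>
  spreads to all points, at the price of at most two grid levels of height \<open>1 / m\<close>.\<close>

lemma polya_uniform_cdf:
  fixes F :: "real \<Rightarrow> real" and G :: "nat \<Rightarrow> real \<Rightarrow> real"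
  assumes contF: "\<And>x. isCont F x"
    and monoF: "mono F" and F0: "\<And>x. 0 \<le> F x" and F1: "\<And>x. F x \<le> 1"
    and bot: "(F \<longlongrightarrow> 0) at_bot" and top: "(F \<longlongrightarrow> 1) at_top"
    and monoG: "\<And>n. mono (G n)" and G0: "\<And>n x. 0 \<le> G n x" and G1: "\<And>n x. G n x \<le> 1"
    and conv: "\<And>x. (\<lambda>n. G n x) \<longlonglongrightarrow> F x"
    and e: "e > 0"
  shows "eventually (\<lambda>n. \<forall>x. \<bar>G n x - F x\<bar> \<le> e) sequentially"
proof -
  obtain m :: nat where m: "2 / real m < e / 2" "m > 0"
  proof -
    obtain m :: nat where "4 / e < real m" using reals_Archimedean2 by blast
    moreover from this have "m > 0" using e by (intro gr0I) (auto simp: field_simps)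
    ultimately show ?thesis using e by (intro that[of m]) (auto simp: field_simps)
  qed
  have m': "1 / real m < e / 2"
    using divide_right_mono[of 1 2 "real m"] m(1) by simp
  have "\<exists>x. F x = real j / real m" if j: "j \<in> {1..<m}" for j
  proof -
    have "0 < real j / real m" "real j / real m < 1" using j by auto
    have "eventually (\<lambda>x. F x < real j / real m) at_bot"
      by (rule order_tendstoD(2)[OF bot]) fact
    then obtain a where a: "\<And>x. x \<le> a \<Longrightarrow> F x < real j / real m" by (auto simp: eventually_at_bot_linorder)
    have "eventually (\<lambda>x. F x > real j / real m) at_top"
      by (rule order_tendstoD(1)[OF top]) fact
    then obtain b where b: "\<And>x. x \<ge> b \<Longrightarrow> F x > real j / real m" by (auto simp: eventually_at_top_linorder)
    have "\<exists>x. min a b \<le> x \<and> x \<le> max a b \<and> F x = real j / real m"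
      using a[of "min a b"] b[of "max a b"] contF by (intro IVT) auto
    then show ?thesis by blast
  qed
  then obtain x where x: "\<And>j. j \<in> {1..<m} \<Longrightarrow> F (x j) = real j / real m" by metis
  have "eventually (\<lambda>n. \<forall>j\<in>{1..<m}. \<bar>G n (x j) - F (x j)\<bar> < e / 2) sequentially"
  proof (intro eventually_ball_finite ballI)
    show "eventually (\<lambda>n. \<bar>G n (x j) - F (x j)\<bar> < e / 2) sequentially" for j
      using tendstoD[OF conv[of "x j"], of "e / 2"] e by (simp add: dist_real_def)
  qed simp
  then show ?thesis
  proof eventually_elim
    case (elim n)
    show ?case
    proof
      fix y
      define j where "j = nat \<lfloor>real m * F y\<rfloor>"
      have j: "real j \<le> real m * F y" "real m * F y < real j + 1"
        unfolding j_def using F0[of y] m by (auto simp: of_nat_nat)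
      have j': "real j / real m \<le> F y" "F y < real (Suc j) / real m"
        using j m by (auto simp: field_simps)
      have "G n y \<le> F y + e"
      proof (cases "Suc j < m")
        case True
        have "y \<le> x (Suc j)" using j'(2) x[of "Suc j"] True monoD[OF monoF, of "x (Suc j)" y] by force
        then have "G n y \<le> G n (x (Suc j))" by (rule monoD[OF monoG])
        also have "\<dots> \<le> real (Suc j) / real m + e / 2"
          using elim[rule_format, of "Suc j"] x[of "Suc j"] True
          unfolding abs_less_iff atLeastLessThan_iff by linarith
        also have "real (Suc j) / real m \<le> F y + 1 / real m" using j'(1) by (simp add: add_divide_distrib)
        finally show ?thesis using m' by simp
      next
        case False
        then have "1 \<le> real (Suc j) / real m" using m by (auto simp: field_simps)
        then have "1 \<le> F y + 1 / real m" using j'(1) by (simp add: add_divide_distrib)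
        then show ?thesis using G1[of n y] m' e by simp
      qed
      \<comment> \<open>if \<open>F y = j / m\<close>, the grid point \<open>x j\<close> may lie to the right of \<open>y\<close>, hence one level further down\<close>
      moreover have "F y - e \<le> G n y"
      proof (cases "2 \<le> j")
        case True
        have jm: "j \<le> m" using j F1[of y] by (metis mult_left_le of_nat_0_le_iff of_nat_le_iff order.trans)
        have xx: "F (x (j-1)) = real (j - 1) / real m" by (rule x) (use True jm in auto)
        have "real (j - 1) / real m < F y" using j'(1) True m by (auto simp: field_simps of_nat_diff)
        then have "x (j-1) \<le> y" using xx monoD[OF monoF, of y "x (j-1)"] by force
        then have "G n (x (j-1)) \<le> G n y" by (rule monoD[OF monoG])
        moreover have "real (j - 1) / real m - e / 2 \<le> G n (x (j-1))"
          using elim[rule_format, of "j-1"] xx True jm m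
          unfolding abs_less_iff atLeastLessThan_iff by linarith
        moreover have "F y - 2 / real m \<le> real (j - 1) / real m"
          using j'(2) True by (simp add: of_nat_diff field_simps add_divide_distrib diff_divide_distrib)
        ultimately show ?thesis using m by simp
      next
        case False
        then have "real (Suc j) / real m \<le> 2 / real m" by (intro divide_right_mono) auto
        then show ?thesis using j'(2) m G0[of n y] e by linarith
      qed
      ultimately show "\<bar>G n y - F y\<bar> \<le> e" by auto
    qed
  qed
qed

section \<open>A strong law of large numbers from second moments\<close>

text \<open>Between \<open>r k\<close> and \<open>r (Suc k)\<close> the partial sum changes by at most \<open>B * (r (Suc k) - r k)\<close>, which is
  negligible against \<open>r k\<close>.\<close>

lemma average_tendsto_0_if_subseq:
  fixes z :: "nat \<Rightarrow> 'b::real_normed_vector" and r :: "nat \<Rightarrow> nat"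
  assumes bound: "\<And>k. k \<ge> 1 \<Longrightarrow> norm (z k) \<le> B"
    and top: "filterlim r at_top sequentially"
    and ratio: "(\<lambda>k. (real (r (Suc k)) - real (r k)) / real (r k)) \<longlonglongrightarrow> 0"
    and sub: "(\<lambda>k. norm (\<Sum>i\<in>{1..r k}. z i) / real (r k)) \<longlonglongrightarrow> 0"
  shows "(\<lambda>n. norm (\<Sum>i\<in>{1..n}. z i) / real n) \<longlonglongrightarrow> 0"
proof (rule LIMSEQ_I)
  fix e :: real assume e: "e > 0"
  define S where "S n = (\<Sum>i\<in>{1..n}. z i)" for n
  have B: "B \<ge> 0" using bound[of 1] norm_ge_zero[of "z 1"] by linarith
  have "(\<lambda>k. norm (S (r k)) / real (r k) + B * ((real (r (Suc k)) - real (r k)) / real (r k))) \<longlonglongrightarrow> 0 + B * 0"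
    using sub ratio unfolding S_def by (intro tendsto_intros)
  then have "eventually (\<lambda>k. norm (S (r k)) / real (r k) + B * ((real (r (Suc k)) - real (r k)) / real (r k)) < e) sequentially"
    using e by (auto intro: order_tendstoD)
  moreover have "eventually (\<lambda>k. 1 \<le> r k) sequentially"
    using top by (auto simp: filterlim_at_top)
  ultimately obtain K where K: "\<And>k. k \<ge> K \<Longrightarrow> 1 \<le> r k"
      "\<And>k. k \<ge> K \<Longrightarrow> norm (S (r k)) / real (r k) + B * ((real (r (Suc k)) - real (r k)) / real (r k)) < e"
    by (auto simp: eventually_sequentially dest!: eventually_conj) (metis nle_le order_trans)
  have "norm (norm (S n) / real n - 0) < e" if n: "n \<ge> r K" for n
  proof -
    obtain L where L: "\<And>k. k \<ge> L \<Longrightarrow> n < r k"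
      using top unfolding filterlim_at_top eventually_sequentially by (meson Suc_le_lessD)
    have fin: "finite {k. r k \<le> n}"
      by (rule finite_subset[of _ "{..<L}"]) (use L in \<open>force simp: not_le[symmetric]\<close>)+
    define k where "k = Max {k. r k \<le> n}"
    have kin: "r k \<le> n" using Max_in[OF fin] n by (auto simp: k_def)
    have "K \<le> k" unfolding k_def using fin n by (intro Max_ge) auto
    have "n < r (Suc k)"
    proof (rule ccontr)
      assume "\<not> n < r (Suc k)"
      then have "Suc k \<le> k" unfolding k_def using fin by (intro Max_ge) auto
      then show False by simp
    qed
    have rk: "1 \<le> r k" using K(1) \<open>K \<le> k\<close> by blast
    have "S n = S (r k) + (\<Sum>i\<in>{r k<..n}. z i)"
      unfolding S_def using kin by (subst sum.union_disjoint[symmetric]) (auto intro!: sum.cong)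
    then have "norm (S n) \<le> norm (S (r k)) + norm (\<Sum>i\<in>{r k<..n}. z i)"
      by (simp add: norm_triangle_ineq)
    also have "norm (\<Sum>i\<in>{r k<..n}. z i) \<le> of_nat (card {r k<..n}) * B"
      by (rule sum_norm_bound) (use bound in auto)
    also have "\<dots> \<le> (real (r (Suc k)) - real (r k)) * B"
      using kin \<open>n < r (Suc k)\<close> B by (intro mult_right_mono) auto
    finally have "norm (S n) \<le> norm (S (r k)) + B * (real (r (Suc k)) - real (r k))" by (simp add: mult.commute)
    then have "norm (S n) / real n \<le> (norm (S (r k)) + B * (real (r (Suc k)) - real (r k))) / real (r k)"
      using kin rk B \<open>n < r (Suc k)\<close> by (intro frac_le) auto
    also have "\<dots> < e" using K(2)[OF \<open>K \<le> k\<close>] by (simp add: add_divide_distrib)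
    finally show ?thesis by simp
  qed
  then show "\<exists>no. \<forall>n\<ge>no. norm (norm (\<Sum>i = 1..n. z i) / real n - 0) < e"
    unfolding S_def by blast
qed

text \<open>The sum of the \<open>f k\<close> has a finite integral, so it is finite almost everywhere.\<close>

lemma AE_tendsto_0_if_summable_integral:
  fixes f :: "nat \<Rightarrow> 'a \<Rightarrow> real"
  assumes int: "\<And>k. integrable M (f k)" and nonneg: "\<And>k x. 0 \<le> f k x"
    and summable: "summable (\<lambda>k. integral\<^sup>L M (f k))"
  shows "AE x in M. (\<lambda>k. f k x) \<longlonglongrightarrow> 0"
proof -
  have [measurable]: "f k \<in> borel_measurable M" for k using int by auto
  have "(\<integral>\<^sup>+x. (\<Sum>k. ennreal (f k x)) \<partial>M) = (\<Sum>k. \<integral>\<^sup>+x. ennreal (f k x) \<partial>M)"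
    by (rule nn_integral_suminf) auto
  also have "\<dots> = (\<Sum>k. ennreal (integral\<^sup>L M (f k)))"
    using int nonneg by (simp add: nn_integral_eq_integral)
  also have "\<dots> \<noteq> \<infinity>"
    using summable nonneg by (simp add: suminf_ennreal2)
  finally have "AE x in M. (\<Sum>k. ennreal (f k x)) \<noteq> \<infinity>"
    by (intro nn_integral_noteq_infinite) auto
  then show ?thesis
  proof eventually_elim
    case (elim x)
    then have "summable (\<lambda>k. f k x)"
      using nonneg by (intro summable_suminf_not_top) auto
    then show ?case by (rule summable_LIMSEQ_zero)
  qed
qed

text \<open>A strong law from a logarithmic rate for the second moments. On the subsequence
  \<open>r k = \<lfloor>exp (sqrt k)\<rfloor>\<close> the rate \<open>ln n powr - p\<close> becomes \<open>k powr - (p / 2)\<close>, which is summable as \<open>p > 2\<close>,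
  while \<open>sqrt k\<close> grows slowly enough for \<open>r (Suc k) / r k\<close> to tend to 1.\<close>

lemma (in prob_space) AE_average_tendsto_0:
  fixes Z :: "nat \<Rightarrow> 'a \<Rightarrow> complex"
  assumes meas: "\<And>k. k \<ge> 1 \<Longrightarrow> Z k \<in> borel_measurable M"
    and bound: "\<And>k \<omega>. k \<ge> 1 \<Longrightarrow> norm (Z k \<omega>) \<le> B"
    and p: "p > 2"
    and V: "(\<lambda>n. expectation (\<lambda>\<omega>. (norm (\<Sum>k\<in>{1..n}. Z k \<omega>) / real n)\<^sup>2)) \<in> O(\<lambda>n. ln (real n) powr (- p))"
  shows "AE \<omega> in M. (\<lambda>n. norm (\<Sum>k\<in>{1..n}. Z k \<omega>) / real n) \<longlonglongrightarrow> 0"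
proof -
  define r where "r k = nat \<lfloor>exp (sqrt (real k))\<rfloor>" for k :: nat
  have r_top: "filterlim r at_top sequentially"
    unfolding r_def by real_asymp
  have r_ratio: "(\<lambda>k. (real (r (Suc k)) - real (r k)) / real (r k)) \<longlonglongrightarrow> 0"
    unfolding r_def by real_asymp
  have r_ln: "(\<lambda>k. ln (real (r k)) powr (-p)) \<in> O(\<lambda>k. real k powr (-(p/2)))"
    unfolding r_def using p by real_asymp
  define A where "A n \<omega> = norm (\<Sum>k\<in>{1..n}. Z k \<omega>) / real n" for n \<omega>
  have [measurable]: "A n \<in> borel_measurable M" for n
    unfolding A_def using meas by (intro borel_measurable_divide borel_measurable_norm borel_measurable_sum) auto
  have B: "B \<ge> 0" using bound[of 1 undefined] norm_ge_zero[of "Z 1 undefined"] by linarith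
  have A0: "A n \<omega> \<ge> 0" for n \<omega> by (simp add: A_def)
  have AB: "A n \<omega> \<le> B" for n \<omega>
  proof -
    have "norm (\<Sum>k\<in>{1..n}. Z k \<omega>) \<le> of_nat (card {1..n}) * B"
      by (rule sum_norm_bound) (use bound in auto)
    then show ?thesis using B by (cases "n = 0") (auto simp: A_def divide_le_eq mult.commute)
  qed
  have "AE \<omega> in M. (\<lambda>k. (A (r k) \<omega>)\<^sup>2) \<longlonglongrightarrow> 0"
  proof (rule AE_tendsto_0_if_summable_integral)
    show "integrable M (\<lambda>\<omega>. (A (r k) \<omega>)\<^sup>2)" for k
      by (rule integrable_const_bound[of _ "B\<^sup>2"]) (auto intro!: power_mono A0 AB)
    have "(\<lambda>k. expectation (\<lambda>\<omega>. (A (r k) \<omega>)\<^sup>2)) \<in> O(\<lambda>k. ln (real (r k)) powr (-p))"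
      using landau_o.big.compose[OF V r_top] by (simp add: A_def)
    also note r_ln
    finally show "summable (\<lambda>k. expectation (\<lambda>\<omega>. (A (r k) \<omega>)\<^sup>2))"
      by (rule summable_comparison_test_bigo[rotated]) (use p in \<open>simp add: summable_real_powr_iff\<close>)
  qed simp
  then show ?thesis
  proof eventually_elim
    case (elim \<omega>)
    have "(\<lambda>k. A (r k) \<omega>) \<longlonglongrightarrow> 0"
      using tendsto_real_sqrt[OF elim] A0 by simp
    then show ?case
      unfolding A_def by (intro average_tendsto_0_if_subseq[OF bound r_top r_ratio])
  qed
qed

section \<open>Second moments of exponentials of a Gaussian process\<close>

text \<open>Stated through moments, the formula covers the degenerate law, for which both sides are 1.\<close>

lemma Re_char_centered_gaussian:
  assumes law: "gaussian_law \<nu>" and mean: "(\<integral>x. x \<partial>\<nu>) = 0"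
  shows "Re (char \<nu> s) = exp (- (s\<^sup>2 * (\<integral>x. x\<^sup>2 \<partial>\<nu>)) / 2)"
  using law unfolding gaussian_law_def
proof (elim disjE exE conjE)
  fix \<mu> \<sigma> :: real
  assume \<sigma>: "0 < \<sigma>" and \<nu>: "\<nu> = density lborel (normal_density \<mu> \<sigma>)"
  interpret prob_space \<nu> unfolding \<nu> by (rule prob_space_normal_density[OF \<sigma>])
  have "(\<integral>x. x \<partial>\<nu>) = \<mu>"
    unfolding \<nu> using integral_normal_moment_nz_1[OF \<sigma>, of \<mu>] by (subst integral_density) auto
  then have \<mu>: "\<mu> = 0" using mean by simp
  have "(\<integral>x. x\<^sup>2 \<partial>\<nu>) = \<sigma>\<^sup>2"
    unfolding \<nu> \<mu> using integral_normal_moment_even[OF \<sigma>, of 0 1] by (subst integral_density) (auto simp: fact_numeral)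
  moreover have "distributed \<nu> lborel (\<lambda>x. (x - 0) / \<sigma>) std_normal_density"
    unfolding normal_standard_normal_convert[OF \<sigma>, symmetric]
    by (auto simp: distributed_def \<nu> \<mu> distr_id2)
  then have "distr \<nu> borel (\<lambda>x. x / \<sigma>) = std_normal_distribution"
    by (auto simp: distributed_def cong: distr_cong)
  moreover have "char \<nu> s = char (distr \<nu> borel (\<lambda>x. x / \<sigma>)) (s * \<sigma>)"
    unfolding char_def using \<sigma> by (subst integral_distr) (auto simp: \<nu>)
  ultimately show ?thesis
    by (simp add: char_std_normal_distribution power_mult_distrib)
next
  fix \<mu> :: real
  assume \<nu>: "\<nu> = return borel \<mu>"
  have "\<mu> = 0" using mean unfolding \<nu> by (subst (asm) integral_return) auto
  then show ?thesis unfolding \<nu> char_def by (subst (1 2) integral_return) auto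
qed

context
  fixes M :: "'a measure" and X :: "nat \<Rightarrow> 'a \<Rightarrow> real"
  assumes prob: "prob_space M" and std: "standardized_gaussian_process M X"
begin

interpretation prob_space M by (rule prob)

lemma process_measurable: "k \<ge> 1 \<Longrightarrow> X k \<in> borel_measurable M"
  using std by (auto simp: standardized_gaussian_process_def gaussian_process_def)

lemma process_distr: "k \<ge> 1 \<Longrightarrow> distr M borel (X k) = std_normal_distribution"
  using std by (auto simp: standardized_gaussian_process_def)

lemma process_moments:
  assumes k: "k \<ge> 1"
  shows "integrable M (X k)" "integrable M (\<lambda>\<omega>. (X k \<omega>)\<^sup>2)"
    "expectation (X k) = 0" "expectation (\<lambda>\<omega>. (X k \<omega>)\<^sup>2) = 1"
proof -
  note [measurable] = process_measurable[OF k]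
  have "integrable (distr M borel (X k)) (\<lambda>x. x ^ m)" for m
    unfolding process_distr[OF k] by (rule integrable_std_normal_distribution_moment)
  from this[of 1] this[of 2] show "integrable M (X k)" "integrable M (\<lambda>\<omega>. (X k \<omega>)\<^sup>2)"
    by (simp_all add: integrable_distr_eq)
  have "(\<integral>x. x ^ m \<partial>distr M borel (X k)) = expectation (\<lambda>\<omega>. X k \<omega> ^ m)" for m
    by (rule integral_distr) auto
  from this[of 1] this[of 2] show "expectation (X k) = 0" "expectation (\<lambda>\<omega>. (X k \<omega>)\<^sup>2) = 1"
    unfolding process_distr[OF k]
    using integral_std_normal_distribution_moment_odd[of 1] std_normal_distribution_even_moments[of 1]
    by (simp_all add: fact_numeral)
qed

lemma expectation_cos:
  assumes k: "k \<ge> 1"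
  shows "expectation (\<lambda>\<omega>. cos (s * X k \<omega>)) = exp (- s\<^sup>2 / 2)"
proof -
  note [measurable] = process_measurable[OF k]
  have "expectation (\<lambda>\<omega>. cos (s * X k \<omega>)) = Re (expectation (\<lambda>\<omega>. iexp (s * X k \<omega>)))"
    by (subst integral_Re[symmetric]) (auto simp: Re_exp intro!: integrable_iexp)
  also have "\<dots> = Re (char (distr M borel (X k)) s)"
    unfolding char_def by (subst integral_distr) auto
  also have "\<dots> = exp (- s\<^sup>2 / 2)"
    by (simp only: process_distr[OF k] char_std_normal_distribution Re_complex_of_real)
  finally show ?thesis .
qed

text \<open>The linear functional \<open>x\<^sub>j - x\<^sub>k\<close> of the pair has a Gaussian law, determined by its mean 0 and its
  variance \<open>2 - 2 \<rho>\<close>. That the variance is nonnegative also yields \<open>\<rho> \<le> 1\<close>.\<close>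

lemma expectation_cos_diff:
  assumes j: "j \<ge> 1" and k: "k \<ge> 1" and jk: "j \<noteq> k"
  shows "expectation (\<lambda>\<omega>. cos (s * (X j \<omega> - X k \<omega>))) = exp (- (s\<^sup>2 * (1 - covariance M (X j) (X k))))"
    and "covariance M (X j) (X k) \<le> 1"
proof -
  note [measurable] = process_measurable[OF j] process_measurable[OF k]
  note mom = process_moments[OF j] process_moments[OF k]
  define D where "D = distr M borel (\<lambda>\<omega>. X j \<omega> - X k \<omega>)"
  have "gaussian_law D"
  proof -
    let ?P = "\<Pi>\<^sub>M i\<in>{j,k}. (borel :: real measure)"
    define c :: "nat \<Rightarrow> real" where "c i = (if i = j then 1 else -1)" for i
    have "gaussian_process M X" using std by (simp add: standardized_gaussian_process_def)
    moreover have "finite {j, k} \<and> {j, k} \<noteq> {} \<and> {j, k} \<subseteq> {1..}" using j k by auto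
    ultimately have "multivariate_gaussian_law {j, k} (distr M ?P (\<lambda>\<omega>. \<lambda>i\<in>{j,k}. X i \<omega>))"
      unfolding gaussian_process_def by blast
    then have "gaussian_law (distr (distr M ?P (\<lambda>\<omega>. \<lambda>i\<in>{j,k}. X i \<omega>)) borel (\<lambda>x. \<Sum>i\<in>{j,k}. c i * x i))"
      unfolding multivariate_gaussian_law_def by blast
    also have "distr (distr M ?P (\<lambda>\<omega>. \<lambda>i\<in>{j,k}. X i \<omega>)) borel (\<lambda>x. \<Sum>i\<in>{j,k}. c i * x i)
        = distr M borel ((\<lambda>x. \<Sum>i\<in>{j,k}. c i * x i) \<circ> (\<lambda>\<omega>. \<lambda>i\<in>{j,k}. X i \<omega>))"
    proof (rule distr_distr)
      show "(\<lambda>x. \<Sum>i\<in>{j,k}. c i * x i) \<in> measurable ?P borel"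
        by (intro borel_measurable_sum borel_measurable_times measurable_component_singleton) auto
      show "(\<lambda>\<omega>. \<lambda>i\<in>{j,k}. X i \<omega>) \<in> measurable M ?P"
        by (rule measurable_restrict) auto
    qed
    also have "(\<lambda>x. \<Sum>i\<in>{j,k}. c i * x i) \<circ> (\<lambda>\<omega>. \<lambda>i\<in>{j,k}. X i \<omega>) = (\<lambda>\<omega>. X j \<omega> - X k \<omega>)"
      using jk by (auto simp: c_def fun_eq_iff)
    finally show ?thesis by (simp add: D_def)
  qed
  moreover have "(\<integral>x. x \<partial>D) = 0"
    unfolding D_def using mom by (subst integral_distr) auto
  moreover have var: "(\<integral>x. x\<^sup>2 \<partial>D) = 2 - 2 * covariance M (X j) (X k)"
  proof -
    have int: "integrable M (\<lambda>\<omega>. X j \<omega> * X k \<omega>)"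
    proof (rule Bochner_Integration.integrable_bound)
      show "integrable M (\<lambda>\<omega>. (X j \<omega>)\<^sup>2 + (X k \<omega>)\<^sup>2)" using mom by auto
      have "\<bar>a * b\<bar> \<le> a\<^sup>2 + b\<^sup>2" for a b :: real
      proof -
        have "2 * (\<bar>a\<bar> * \<bar>b\<bar>) \<le> a\<^sup>2 + b\<^sup>2" using sum_squares_bound[of "\<bar>a\<bar>" "\<bar>b\<bar>"] by simp
        moreover have "0 \<le> \<bar>a\<bar> * \<bar>b\<bar>" by simp
        ultimately show ?thesis unfolding abs_mult by linarith
      qed
      then show "AE \<omega> in M. norm (X j \<omega> * X k \<omega>) \<le> norm ((X j \<omega>)\<^sup>2 + (X k \<omega>)\<^sup>2)"
        by (auto intro: order_trans)
    qed auto
    have "(\<integral>x. x\<^sup>2 \<partial>D) = expectation (\<lambda>\<omega>. (X j \<omega>)\<^sup>2 + (X k \<omega>)\<^sup>2 - 2 * (X j \<omega> * X k \<omega>))"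
      unfolding D_def by (subst integral_distr) (auto simp: power2_diff mult.assoc)
    also have "\<dots> = 2 - 2 * expectation (\<lambda>\<omega>. X j \<omega> * X k \<omega>)"
      using mom int by simp
    finally show ?thesis using mom by (simp add: covariance_def)
  qed
  ultimately have "Re (char D s) = exp (- (s\<^sup>2 * (1 - covariance M (X j) (X k))))"
    using Re_char_centered_gaussian[of D s] by (simp only: var) (simp add: right_diff_distrib)
  moreover have "expectation (\<lambda>\<omega>. cos (s * (X j \<omega> - X k \<omega>))) = Re (expectation (\<lambda>\<omega>. iexp (s * (X j \<omega> - X k \<omega>))))"
    by (subst integral_Re[symmetric]) (auto simp: Re_exp intro!: integrable_iexp)
  moreover have "expectation (\<lambda>\<omega>. iexp (s * (X j \<omega> - X k \<omega>))) = char D s"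
    unfolding char_def D_def by (subst integral_distr) auto
  ultimately show "expectation (\<lambda>\<omega>. cos (s * (X j \<omega> - X k \<omega>))) = exp (- (s\<^sup>2 * (1 - covariance M (X j) (X k))))"
    by simp
  have "0 \<le> (\<integral>x. x\<^sup>2 \<partial>D)" by simp
  then show "covariance M (X j) (X k) \<le> 1" unfolding var by simp
qed

end

text \<open>For \<open>a = s\<^sup>2\<close> this bounds the real part of the covariance of \<open>exp (\<i> s X\<^sub>j)\<close> and \<open>exp (\<i> s X\<^sub>k)\<close> linearly in \<open>\<bar>\<rho>\<bar>\<close>, up to
  the degenerate case \<open>\<rho> = 1\<close>. If \<open>\<rho> < 0\<close>, the left-hand side is at most 0.\<close>

lemma exp_neg_diff_le:
  fixes a \<rho> :: real
  assumes "a \<ge> 0" "\<rho> \<le> 1"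
  shows "exp (- (a * (1 - \<rho>))) - exp (- a) \<le> a * \<bar>\<rho>\<bar>"
proof (cases "\<rho> \<ge> 0")
  case True
  have "exp (- (a * (1 - \<rho>))) - exp (- a) = exp (- (a * (1 - \<rho>))) * (1 - exp (- (a * \<rho>)))"
    by (simp add: right_diff_distrib exp_add[symmetric] algebra_simps)
  also have "\<dots> \<le> 1 * (a * \<rho>)"
    using exp_ge_add_one_self[of "- (a * \<rho>)"] assms True by (intro mult_mono) auto
  finally show ?thesis using True by simp
next
  case False
  then have "a * \<rho> \<le> 0" using assms(1) by (simp add: mult_nonneg_nonpos)
  then have "exp (- (a * (1 - \<rho>))) \<le> exp (- a)" by (simp add: algebra_simps)
  moreover have "0 \<le> a * \<bar>\<rho>\<bar>" using assms by simp
  ultimately show ?thesis by linarith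
qed

lemma sum_symmetric_split:
  fixes a :: "nat \<Rightarrow> nat \<Rightarrow> real"
  assumes "\<And>i j. a i j = a j i"
  shows "(\<Sum>j\<in>{1..n}. \<Sum>k\<in>{1..n}. a j k) = (\<Sum>j\<in>{1..n}. a j j) + 2 * (\<Sum>j\<in>{1..n}. \<Sum>i\<in>{1..<j}. a i j)"
proof (induction n)
  case (Suc n)
  have "{1..<Suc n} = {1..n}" by auto
  moreover have "(\<Sum>j\<in>{1..n}. a j (Suc n)) = (\<Sum>j\<in>{1..n}. a (Suc n) j)" by (intro sum.cong assms refl)
  ultimately show ?case using Suc by (simp add: sum.distrib)
qed simp

text \<open>With \<open>c\<close> the common mean of the \<open>cos (s * x k)\<close>, the right-hand side has expectation
  \<open>\<Sum>j k. (E cos (s * (x j - x k)) - c\<^sup>2)\<close>: only laws of the differences \<open>x j - x k\<close> enter.\<close>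

lemma norm_sum_iexp_minus_sq:
  fixes x :: "nat \<Rightarrow> real" and c s :: real
  shows "(norm (\<Sum>k\<in>{1..n}. (iexp (s * x k) - complex_of_real c)))\<^sup>2 =
    (\<Sum>j\<in>{1..n}. \<Sum>k\<in>{1..n}. cos (s * (x j - x k))) - 2 * real n * c * (\<Sum>k\<in>{1..n}. cos (s * x k)) + (real n * c)\<^sup>2"
proof -
  have "(norm (\<Sum>k\<in>{1..n}. (iexp (s * x k) - complex_of_real c)))\<^sup>2 =
     ((\<Sum>k\<in>{1..n}. cos (s * x k)) - real n * c)\<^sup>2 + (\<Sum>k\<in>{1..n}. sin (s * x k))\<^sup>2"
    by (simp add: cmod_power2 Re_exp Im_exp sum_subtractf)
  moreover have "(\<Sum>j\<in>{1..n}. \<Sum>k\<in>{1..n}. cos (s * (x j - x k))) =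
     (\<Sum>k\<in>{1..n}. cos (s * x k))\<^sup>2 + (\<Sum>k\<in>{1..n}. sin (s * x k))\<^sup>2"
    by (simp add: right_diff_distrib cos_diff sum.distrib power2_eq_square sum_product)
  ultimately show ?thesis by (simp add: power2_eq_square algebra_simps)
qed

text \<open>The quantitative core: the diagonal contributes at most \<open>n\<close>, and each off-diagonal pair at most
  \<open>s\<^sup>2\<close> times its absolute covariance.\<close>

lemma expectation_norm_sum_iexp_le:
  fixes X :: "nat \<Rightarrow> 'a \<Rightarrow> real"
  assumes "prob_space M" and std: "standardized_gaussian_process M X"
  shows "(\<integral>\<omega>. (norm (\<Sum>k\<in>{1..n}. (iexp (s * X k \<omega>) - complex_of_real (exp (- s\<^sup>2 / 2)))))\<^sup>2 \<partial>M)
    \<le> real n + s\<^sup>2 * dependence_measure M X n"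
proof -
  interpret prob_space M by fact
  note process = process_measurable[OF \<open>prob_space M\<close> std]
  define c where "c = exp (- s\<^sup>2 / 2)"
  define a where "a j k = expectation (\<lambda>\<omega>. cos (s * (X j \<omega> - X k \<omega>))) - c\<^sup>2" for j k
  have c2: "c\<^sup>2 = exp (- (s\<^sup>2))"
    by (simp add: c_def power2_eq_square exp_add[symmetric])
  have int1: "integrable M (\<lambda>\<omega>. cos (s * X k \<omega>))" if "k \<ge> 1" for k
    using process[OF that] by (intro integrable_const_bound[of _ 1]) auto
  have int2: "integrable M (\<lambda>\<omega>. cos (s * (X j \<omega> - X k \<omega>)))" if "j \<ge> 1" "k \<ge> 1" for j k
    using process[OF that(1)] process[OF that(2)] by (intro integrable_const_bound[of _ 1]) auto
  have "(\<integral>\<omega>. (norm (\<Sum>k\<in>{1..n}. (iexp (s * X k \<omega>) - complex_of_real c)))\<^sup>2 \<partial>M) =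
    (\<Sum>j\<in>{1..n}. \<Sum>k\<in>{1..n}. expectation (\<lambda>\<omega>. cos (s * (X j \<omega> - X k \<omega>))))
      - 2 * real n * c * (\<Sum>k\<in>{1..n}. expectation (\<lambda>\<omega>. cos (s * X k \<omega>))) + (real n * c)\<^sup>2"
  proof -
    have "integrable M (\<lambda>\<omega>. \<Sum>k\<in>{1..n}. cos (s * X k \<omega>))"
      "expectation (\<lambda>\<omega>. \<Sum>k\<in>{1..n}. cos (s * X k \<omega>)) = (\<Sum>k\<in>{1..n}. expectation (\<lambda>\<omega>. cos (s * X k \<omega>)))"
      using int1 by (auto intro!: Bochner_Integration.integral_sum)
    moreover have inner: "integrable M (\<lambda>\<omega>. \<Sum>k\<in>{1..n}. cos (s * (X j \<omega> - X k \<omega>)))"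
      "expectation (\<lambda>\<omega>. \<Sum>k\<in>{1..n}. cos (s * (X j \<omega> - X k \<omega>))) =
        (\<Sum>k\<in>{1..n}. expectation (\<lambda>\<omega>. cos (s * (X j \<omega> - X k \<omega>))))" if "j \<in> {1..n}" for j
      using int2 that by (auto intro!: Bochner_Integration.integral_sum)
    moreover have "integrable M (\<lambda>\<omega>. \<Sum>j\<in>{1..n}. \<Sum>k\<in>{1..n}. cos (s * (X j \<omega> - X k \<omega>)))"
      by (rule Bochner_Integration.integrable_sum) (rule inner(1))
    moreover have "expectation (\<lambda>\<omega>. \<Sum>j\<in>{1..n}. \<Sum>k\<in>{1..n}. cos (s * (X j \<omega> - X k \<omega>))) =
        (\<Sum>j\<in>{1..n}. \<Sum>k\<in>{1..n}. expectation (\<lambda>\<omega>. cos (s * (X j \<omega> - X k \<omega>))))"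
      by (subst Bochner_Integration.integral_sum, rule inner(1), assumption,
          intro sum.cong refl inner(2))
    ultimately show ?thesis
      unfolding norm_sum_iexp_minus_sq using prob_space by simp
  qed
  also have "\<dots> = (\<Sum>j\<in>{1..n}. \<Sum>k\<in>{1..n}. a j k)"
  proof -
    have "(\<Sum>k\<in>{1..n}. expectation (\<lambda>\<omega>. cos (s * X k \<omega>))) = (\<Sum>k\<in>{1..n}. c)"
      using expectation_cos[OF \<open>prob_space M\<close> std, of _ s] by (intro sum.cong) (auto simp: c_def)
    then show ?thesis
      by (simp add: a_def sum_subtractf power2_eq_square)
  qed
  also have "\<dots> = (\<Sum>j\<in>{1..n}. a j j) + 2 * (\<Sum>j\<in>{1..n}. \<Sum>i\<in>{1..<j}. a i j)"
    by (rule sum_symmetric_split) (simp add: a_def cos_diff algebra_simps)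
  also have "\<dots> \<le> (\<Sum>j\<in>{1..n}. 1) + 2 * (\<Sum>j\<in>{1..n}. \<Sum>i\<in>{1..<j}. s\<^sup>2 * \<bar>covariance M (X i) (X j)\<bar>)"
  proof (intro add_mono mult_left_mono sum_mono)
    fix i j assume "j \<in> {1..n}" "i \<in> {1..<j}"
    then have "i \<ge> 1" "j \<ge> 1" "i \<noteq> j" by auto
    note cov = expectation_cos_diff[OF \<open>prob_space M\<close> std this]
    show "a i j \<le> s\<^sup>2 * \<bar>covariance M (X i) (X j)\<bar>"
      unfolding a_def c2 cov(1) using cov(2) exp_neg_diff_le[of "s\<^sup>2" "covariance M (X i) (X j)"] by simp
  qed (simp_all add: a_def prob_space)
  also have "\<dots> = real n + s\<^sup>2 * dependence_measure M X n"
    by (simp add: dependence_measure_def sum_distrib_left mult.left_commute)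
  finally show ?thesis by (simp add: c_def)
qed

section \<open>Empirical measures\<close>

definition empirical_measure :: "(nat \<Rightarrow> real) \<Rightarrow> nat \<Rightarrow> real measure" where
  "empirical_measure x n = distr (uniform_count_measure {1..n}) borel x"

lemma measurable_uniform_count_measure:
  fixes x :: "nat \<Rightarrow> real"
  shows "x \<in> borel_measurable (uniform_count_measure A)"
  by (simp add: measurable_def space_uniform_count_measure sets_uniform_count_measure)

lemma real_distribution_empirical_measure:
  assumes "n \<ge> 1"
  shows "real_distribution (empirical_measure x n)"
proof -
  interpret prob_space "uniform_count_measure {1..n}"
    by (rule prob_space_uniform_count_measure) (use assms in auto)
  have "prob_space (empirical_measure x n)"
    unfolding empirical_measure_def by (rule prob_space_distr[OF measurable_uniform_count_measure])
  then show ?thesis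
    by (auto simp: real_distribution_def real_distribution_axioms_def empirical_measure_def)
qed

lemma integral_empirical_measure:
  fixes f :: "real \<Rightarrow> 'b::{banach, second_countable_topology}"
  assumes f: "f \<in> borel_measurable borel"
  shows "integral\<^sup>L (empirical_measure x n) f = (\<Sum>k\<in>{1..n}. f (x k)) /\<^sub>R real n"
proof -
  have "integral\<^sup>L (empirical_measure x n) f = (\<integral>k. f (x k) \<partial>uniform_count_measure {1..n})"
    unfolding empirical_measure_def by (rule integral_distr[OF measurable_uniform_count_measure f])
  also have "\<dots> = (\<Sum>k\<in>{1..n}. f (x k)) /\<^sub>R real n"
    unfolding uniform_count_measure_def
    by (subst lebesgue_integral_point_measure_finite) (simp_all add: scaleR_sum_right inverse_eq_divide)
  finally show ?thesis .
qed

lemma measure_empirical_measure: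
  assumes "A \<in> sets borel"
  shows "measure (empirical_measure x n) A = (\<Sum>k\<in>{1..n}. indicator A (x k)) / real n"
  using integral_empirical_measure[of "indicat_real A" x n] assms
  by (simp add: empirical_measure_def divide_inverse_commute)

text \<open>Applied to \<open>{x. \<Phi> x \<le> t}\<close>, this replaces an inverse of \<open>\<Phi>\<close>: the set is closed as \<open>\<Phi>\<close> is
  continuous and downward closed as \<open>\<Phi>\<close> is monotone. The first two cases arise for \<open>t\<close> outside the
  range of \<open>\<Phi>\<close>.\<close>

lemma closed_down_set_cases:
  fixes A :: "real set"
  assumes closed: "closed A" and down: "\<And>x y. y \<in> A \<Longrightarrow> x \<le> y \<Longrightarrow> x \<in> A"
  obtains "A = {}" | "A = UNIV" | a where "A = {..a}"
proof (cases "A = {} \<or> A = UNIV")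
  case True then show ?thesis using that by auto
next
  case False
  then obtain b where "b \<notin> A" by auto
  have "bdd_above A" using down \<open>b \<notin> A\<close> by (intro bdd_aboveI[of _ b]) (meson linear)
  then have "Sup A \<in> A" using False closed closed_contains_Sup by blast
  then have "A = {..Sup A}" using down \<open>bdd_above A\<close> by (auto intro: cSup_upper)
  then show ?thesis using that by blast
qed

interpretation std_normal: real_distribution std_normal_distribution
  by (rule real_dist_normal_dist)

lemma isCont_std_normal_cdf: "isCont std_normal_cdf x"
proof -
  have "emeasure std_normal_distribution {x} = 0"
    using AE_lborel_singleton[of x]
    by (subst emeasure_density) (auto simp: nn_integral_0_iff_AE indicator_def elim: eventually_mono)
  then show ?thesis
    unfolding std_normal_cdf_def std_normal.isCont_cdf by (simp add: measure_def)
qed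

lemma mono_std_normal_cdf: "mono std_normal_cdf"
  unfolding std_normal_cdf_def by (intro monoI std_normal.cdf_nondecreasing)

lemma measurable_std_normal_cdf [measurable]: "std_normal_cdf \<in> borel_measurable borel"
  by (rule borel_measurable_mono[OF mono_std_normal_cdf])

lemma empirical_cdf_eq_measure:
  "empirical_cdf X n t \<omega> = measure (empirical_measure (\<lambda>k. X k \<omega>) n) {x. std_normal_cdf x \<le> t}"
proof -
  have "{x. std_normal_cdf x \<le> t} \<in> sets borel" by simp
  then show ?thesis
    by (simp add: measure_empirical_measure empirical_cdf_def indicator_def)
qed

lemma expectation_empirical_cdf:
  assumes "prob_space M" and std: "standardized_gaussian_process M X" and n: "n \<ge> 1"
  shows "integral\<^sup>L M (empirical_cdf X n t) = measure std_normal_distribution {x. std_normal_cdf x \<le> t}"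
proof -
  interpret prob_space M by fact
  define A where "A = {x. std_normal_cdf x \<le> t}"
  have [measurable]: "A \<in> sets borel" unfolding A_def by simp
  have *: "integrable M (\<lambda>\<omega>. indicat_real A (X k \<omega>))"
    "expectation (\<lambda>\<omega>. indicat_real A (X k \<omega>)) = measure std_normal_distribution A" if k: "k \<ge> 1" for k
  proof -
    note [measurable] = process_measurable[OF \<open>prob_space M\<close> std k]
    show "integrable M (\<lambda>\<omega>. indicat_real A (X k \<omega>))"
      by (rule integrable_const_bound[of _ 1]) (auto simp: indicator_def)
    have "expectation (\<lambda>\<omega>. indicat_real A (X k \<omega>)) = integral\<^sup>L (distr M borel (X k)) (indicat_real A)"
      by (subst integral_distr) auto
    then show "expectation (\<lambda>\<omega>. indicat_real A (X k \<omega>)) = measure std_normal_distribution A"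
      by (simp add: process_distr[OF \<open>prob_space M\<close> std k])
  qed
  have "empirical_cdf X n t = (\<lambda>\<omega>. 1 / real n * (\<Sum>k\<in>{1..n}. indicat_real A (X k \<omega>)))"
    by (simp add: empirical_cdf_def fun_eq_iff A_def indicator_def)
  then show ?thesis using * n by (simp add: A_def[symmetric])
qed

text \<open>The passage from \<open>t\<close> to half-lines: for each \<open>t\<close> the deviation is the difference of the empirical and the
  normal measure of one set \<open>{..a}\<close> (or is 0), so Polya's theorem bounds it uniformly in \<open>t\<close>. The index
  is shifted because the empirical measure of an empty sample is not a probability measure.\<close>

lemma SUP_empirical_cdf_tendsto_0:
  assumes M: "prob_space M" and std: "standardized_gaussian_process M X"
    and weak: "weak_conv_m (\<lambda>n. empirical_measure (\<lambda>k. X k \<omega>) (Suc n)) std_normal_distribution"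
  shows "(\<lambda>n. SUP t::real. \<bar>empirical_cdf X n t \<omega> - integral\<^sup>L M (empirical_cdf X n t)\<bar>) \<longlonglongrightarrow> 0"
proof -
  define E where "E n = empirical_measure (\<lambda>k. X k \<omega>) (Suc n)" for n
  interpret E: real_distribution "E n" for n
    unfolding E_def by (rule real_distribution_empirical_measure) simp
  have conv: "(\<lambda>n. cdf (E n) x) \<longlonglongrightarrow> std_normal_cdf x" for x
    using weak isCont_std_normal_cdf[of x]
    by (simp add: weak_conv_m_def weak_conv_def E_def std_normal_cdf_def)
  define D where "D n t = \<bar>empirical_cdf X (Suc n) t \<omega> - integral\<^sup>L M (empirical_cdf X (Suc n) t)\<bar>" for n t
  have D_le: "D n t \<le> e" if e: "e > 0" and close: "\<And>x. \<bar>cdf (E n) x - std_normal_cdf x\<bar> \<le> e" for n t e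
  proof -
    let ?A = "{x. std_normal_cdf x \<le> t}"
    have D: "D n t = \<bar>measure (E n) ?A - measure std_normal_distribution ?A\<bar>"
      unfolding D_def E_def by (simp add: empirical_cdf_eq_measure expectation_empirical_cdf[OF M std])
    have "closed ?A"
      using isCont_std_normal_cdf
      by (intro closed_Collect_le continuous_at_imp_continuous_on) auto
    then show ?thesis
    proof (cases rule: closed_down_set_cases)
      show "x \<in> ?A" if "y \<in> ?A" "x \<le> y" for x y
        using that monoD[OF mono_std_normal_cdf, of x y] by auto
    next
      assume "?A = {}" then show ?thesis using e unfolding D by simp
    next
      assume "?A = UNIV" then show ?thesis
        using e E.prob_space std_normal.prob_space unfolding D by simp
    next
      fix a assume "?A = {..a}" then show ?thesis
        using close[of a] unfolding D by (simp add: cdf_def2 std_normal_cdf_def)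
    qed
  qed
  have "(\<lambda>n. SUP t. D n t) \<longlonglongrightarrow> 0"
  proof (rule LIMSEQ_I)
    fix e :: real assume e: "e > 0"
    have "eventually (\<lambda>n. \<forall>x. \<bar>cdf (E n) x - std_normal_cdf x\<bar> \<le> e / 2) sequentially"
      by (rule polya_uniform_cdf[OF isCont_std_normal_cdf mono_std_normal_cdf])
         (use e conv E.cdf_nondecreasing std_normal.cdf_lim_at_bot std_normal.cdf_lim_at_top_prob in
           \<open>auto simp: std_normal_cdf_def std_normal.cdf_nonneg std_normal.cdf_bounded_prob
              E.cdf_nonneg E.cdf_bounded_prob intro!: monoI\<close>)
    then obtain n0 where n0: "\<And>n x. n \<ge> n0 \<Longrightarrow> \<bar>cdf (E n) x - std_normal_cdf x\<bar> \<le> e / 2"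
      by (auto simp: eventually_sequentially)
    have "norm ((SUP t. D n t) - 0) < e" if n: "n \<ge> n0" for n
    proof -
      have le: "D n t \<le> e / 2" for t using D_le[of "e/2" n t] n0[OF n] e by simp
      then have "(SUP t. D n t) \<le> e / 2" by (intro cSUP_least) auto
      moreover have "D n 0 \<le> (SUP t. D n t)"
        using le by (intro cSUP_upper bdd_aboveI2[of _ _ "e/2"]) auto
      moreover have "0 \<le> D n 0" by (simp add: D_def)
      ultimately show ?thesis using e by simp
    qed
    then show "\<exists>no. \<forall>n\<ge>no. norm ((SUP t. D n t) - 0) < e" by blast
  qed
  then show ?thesis
    unfolding D_def by (rule LIMSEQ_imp_Suc)
qed

section \<open>The Glivenko-Cantelli theorem\<close>

theorem theorem2:
  fixes M :: "'a measure" and X :: "nat \<Rightarrow> 'a \<Rightarrow> real" and \<delta> :: real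
  assumes "prob_space M"
    and "standardized_gaussian_process M X"
    and "\<delta> > 0"
    and "dependence_measure M X \<in> O(\<lambda>n. real n ^ 2 * ln (real n) powr (- 3 - \<delta>))"
  shows "AE \<omega> in M. (\<lambda>n. SUP t::real.
      \<bar>empirical_cdf X n t \<omega> - integral\<^sup>L M (empirical_cdf X n t)\<bar>) \<longlonglongrightarrow> 0"
proof -
  interpret prob_space M by fact
  interpret pair_sigma_finite M "lborel :: real measure" ..
  note process = process_measurable[OF assms(1,2)]
  define Z where "Z s k \<omega> = iexp (s * X k \<omega>) - complex_of_real (exp (- s\<^sup>2 / 2))" for s k \<omega>
  define A where "A s n \<omega> = norm (\<Sum>k\<in>{1..n}. Z s k \<omega>) / real n" for s n \<omega>
  have fixed_s: "AE \<omega> in M. (\<lambda>n. A s n \<omega>) \<longlonglongrightarrow> 0" for s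
    unfolding A_def
  proof (rule AE_average_tendsto_0)
    show "Z s k \<in> borel_measurable M" if "k \<ge> 1" for k
      using process[OF that] unfolding Z_def by measurable
    show "norm (Z s k \<omega>) \<le> 2" for k \<omega>
    proof -
      have "norm (Z s k \<omega>) \<le> norm (iexp (s * X k \<omega>)) + norm (complex_of_real (exp (- s\<^sup>2 / 2)))"
        unfolding Z_def by (rule norm_triangle_ineq4)
      moreover have "norm (iexp (s * X k \<omega>)) = 1" by (rule norm_exp_i_times)
      moreover have "norm (complex_of_real (exp (- s\<^sup>2 / 2))) \<le> 1" by simp
      ultimately show ?thesis by linarith
    qed
    show "3 + \<delta> > 2" using assms(3) by simp
    let ?L = "\<lambda>n::nat. ln (real n) powr (- (3 + \<delta>))"
    have "(\<lambda>n. expectation (\<lambda>\<omega>. (norm (\<Sum>k\<in>{1..n}. Z s k \<omega>) / real n)\<^sup>2))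
        \<in> O(\<lambda>n. 1 / real n + s\<^sup>2 * (dependence_measure M X n / real n ^ 2))"
    proof (rule landau_o.big_mono, rule always_eventually, rule allI)
      fix n
      have "expectation (\<lambda>\<omega>. (norm (\<Sum>k\<in>{1..n}. Z s k \<omega>) / real n)\<^sup>2)
          = expectation (\<lambda>\<omega>. (norm (\<Sum>k\<in>{1..n}. Z s k \<omega>))\<^sup>2) / real n ^ 2"
        by (simp add: power_divide)
      also have "\<dots> \<le> (real n + s\<^sup>2 * dependence_measure M X n) / real n ^ 2"
        unfolding Z_def by (intro divide_right_mono expectation_norm_sum_iexp_le assms) simp
      also have "\<dots> = 1 / real n + s\<^sup>2 * (dependence_measure M X n / real n ^ 2)"
        by (simp add: add_divide_distrib power2_eq_square)
      finally show "norm (expectation (\<lambda>\<omega>. (norm (\<Sum>k\<in>{1..n}. Z s k \<omega>) / real n)\<^sup>2))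
          \<le> norm (1 / real n + s\<^sup>2 * (dependence_measure M X n / real n ^ 2))"
        by (simp add: power_divide)
    qed
    also have "(\<lambda>n. 1 / real n + s\<^sup>2 * (dependence_measure M X n / real n ^ 2)) \<in> O(?L)"
    proof (rule sum_in_bigo)
      show "(\<lambda>n. 1 / real n) \<in> O(?L)" using assms(3) by real_asymp
      have "(\<lambda>n. dependence_measure M X n * (1 / real n ^ 2)) \<in>
          O(\<lambda>n. real n ^ 2 * ln (real n) powr (- 3 - \<delta>) * (1 / real n ^ 2))"
        by (intro landau_o.big.mult assms(4) landau_o.big_refl)
      also have "(\<lambda>n. real n ^ 2 * ln (real n) powr (- 3 - \<delta>) * (1 / real n ^ 2)) \<in> O(?L)"
        using assms(3) by real_asymp
      finally have "(\<lambda>n. dependence_measure M X n / real n ^ 2) \<in> O(?L)"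
        by simp
      then show "(\<lambda>n. s\<^sup>2 * (dependence_measure M X n / real n ^ 2)) \<in> O(?L)"
        by (cases "s = 0") (simp_all del: times_divide_eq_right)
    qed
    finally show "(\<lambda>n. expectation (\<lambda>\<omega>. (norm (\<Sum>k\<in>{1..n}. Z s k \<omega>) / real n)\<^sup>2)) \<in> O(?L)" .
  qed
  \<comment> \<open>Fubini exchanges the quantifiers: for almost all \<open>\<omega>\<close>, convergence holds for almost all \<open>s\<close>\<close>
  have joint: "(\<lambda>(\<omega>, s). A s n \<omega>) \<in> borel_measurable (M \<Otimes>\<^sub>M lborel)" for n
  proof -
    have "(\<lambda>p. Z (snd p) k (fst p)) \<in> borel_measurable (M \<Otimes>\<^sub>M lborel)" if "k \<ge> 1" for k
      using process[OF that] unfolding Z_def by measurable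
    then have "(\<lambda>p. norm (\<Sum>k\<in>{1..n}. Z (snd p) k (fst p)) / real n) \<in> borel_measurable (M \<Otimes>\<^sub>M lborel)"
      by (intro borel_measurable_divide measurable_compose[OF _ borel_measurable_norm] borel_measurable_sum) auto
    then show ?thesis by (simp add: A_def case_prod_beta)
  qed
  have "AE \<omega> in M. AE s in lborel. (\<lambda>n. A s n \<omega>) \<longlonglongrightarrow> 0"
  proof (subst AE_commute)
    have "Measurable.pred (M \<Otimes>\<^sub>M lborel) (\<lambda>p. (\<lambda>n. A (snd p) n (fst p)) \<longlonglongrightarrow> 0)"
      using joint by (intro pred_tendsto_0) (simp add: case_prod_beta)
    then show "{p \<in> space (M \<Otimes>\<^sub>M lborel). (\<lambda>n. A (snd p) n (fst p)) \<longlonglongrightarrow> 0} \<in> sets (M \<Otimes>\<^sub>M lborel)"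
      by (simp add: pred_def)
    show "AE s in lborel. AE \<omega> in M. (\<lambda>n. A s n \<omega>) \<longlonglongrightarrow> 0"
      using fixed_s by simp
  qed
  then show ?thesis
  proof eventually_elim
    case (elim \<omega>)
    let ?E = "\<lambda>n. empirical_measure (\<lambda>k. X k \<omega>) (Suc n)"
    have "weak_conv_m ?E std_normal_distribution"
    proof (rule levy_continuity_AE)
      show "AE s in lborel. (\<lambda>n. char (?E n) s) \<longlonglongrightarrow> char std_normal_distribution s"
        using elim
      proof eventually_elim
        case (elim s)
        have "norm (char (?E n) s - char std_normal_distribution s) = A s (Suc n) \<omega>" for n
        proof -
          have "char (?E n) s = (\<Sum>k\<in>{1..Suc n}. iexp (s * X k \<omega>)) /\<^sub>R real (Suc n)"
            unfolding char_def by (rule integral_empirical_measure) measurable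
          then have "char (?E n) s - char std_normal_distribution s
              = (\<Sum>k\<in>{1..Suc n}. Z s k \<omega>) /\<^sub>R real (Suc n)"
            by (simp add: Z_def sum_subtractf char_std_normal_distribution scaleR_diff_right
                scaleR_conv_of_real right_diff_distrib mult.assoc[symmetric] del: of_nat_Suc sum.cl_ivl_Suc)
          then show ?thesis
            by (simp add: A_def divide_inverse_commute del: of_nat_Suc sum.cl_ivl_Suc)
        qed
        then have "(\<lambda>n. norm (char (?E n) s - char std_normal_distribution s)) \<longlonglongrightarrow> 0"
          using LIMSEQ_Suc[OF elim] by simp
        then show ?case by (simp only: tendsto_norm_zero_iff LIM_zero_iff)
      qed
    qed (auto intro: real_distribution_empirical_measure std_normal.real_distribution_axioms)
    then show ?case by (rule SUP_empirical_cdf_tendsto_0[OF assms(1,2)])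
  qed
qed

end
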